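(* Let $F$ be a strictly sign-coherent ice quiver whose mutable subquiver is a fork on $n$ mutable vertices. Then there exists a mutation sequence of length at most $2n+3$ ending in an ice quiver whose mutable subquiver is a fork and which has at least $n-1$ red vertices.
   Context: A quiver is a finite directed multigraph with no loops and no 2-cycles; for vertices $i,j$, $f_{ij}$ (or $q_{ij}$) denotes the number of arrows $i\to j$, counted negatively (as minus the number of arrows $j\to i$) if arrows go from $j$ to $i$. An ice quiver is a quiver whose vertices are partitioned into mutable and frozen; its mutable subquiver is the full subquiver on its mutable vertices. Mutation at a mutable vertex $k$: (1) for every path $a\to k\to b$ add an arrow $a\to b$; (2) reverse all arrows incident to $k$; (3) remove 2-cycles created. Mutations are only performed at mutable vertices. A mutable vertex $i$ is green if there is at least one arrow between $i$ and a frozen vertex and all such arrows point from $i$ to frozen vertices; red if there is at least one such arrow and all point from frozen vertices to $i$; blue if there are no arrows between $i$ and frozen vertices. An ice quiver is strictly sign-coherent if every ice quiver obtained from it by any sequence of mutations has every mutable vertex red or green. A quiver is abundant if there are at least two arrows between every pair of distinct vertices; acyclic if it has no directed cycle. A fork is an abundant quiver $F$ that is not acyclic and has a vertex $r$ (the point of return) such that: for all $i\in F^-(r)$ and $j\in F^+(r)$ we have $f_{ji}>f_{ir}$ and $f_{ji}>f_{rj}$, where $F^-(r)$ is the set of vertices with arrows to $r$ and $F^+(r)$ the set of vertices with arrows from $r$; and the full subquiver $F\setminus\{r\}$ on the remaining vertices is acyclic. *)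

theory Defs
  imports Main
begin

text \<open>
  A directed multigraph is given by its vertex set and, for each ordered pair \<open>(i, j)\<close>, the number
  of arrows \<open>i \<rightarrow> j\<close>. The operations below are defined on record schemes so that they
  apply to quivers and to ice quivers alike.
\<close>

record 'v quiver =
  verts :: "'v set"
  arrows :: "'v \<Rightarrow> 'v \<Rightarrow> nat"

record 'v ice_quiver = "'v quiver" +
  frozen :: "'v set"

definition is_quiver :: "('v, 'z) quiver_scheme \<Rightarrow> bool" where
  "is_quiver Q \<longleftrightarrow>
     finite (verts Q) \<and>
     (\<forall>i j. arrows Q i j > 0 \<longrightarrow> i \<in> verts Q \<and> j \<in> verts Q) \<and>
     (\<forall>i. arrows Q i i = 0) \<and>
     (\<forall>i j. \<not> (arrows Q i j > 0 \<and> arrows Q j i > 0))"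

definition is_ice_quiver :: "'v ice_quiver \<Rightarrow> bool" where
  "is_ice_quiver Q \<longleftrightarrow> is_quiver Q \<and> frozen Q \<subseteq> verts Q"

definition mutables :: "'v ice_quiver \<Rightarrow> 'v set" where
  "mutables Q = verts Q - frozen Q"

definition full_subquiver :: "('v, 'z) quiver_scheme \<Rightarrow> 'v set \<Rightarrow> 'v quiver" where
  "full_subquiver Q S =
     \<lparr>verts = verts Q \<inter> S,
      arrows = (\<lambda>i j. if i \<in> verts Q \<inter> S \<and> j \<in> verts Q \<inter> S then arrows Q i j else 0)\<rparr>"

definition mutable_subquiver :: "'v ice_quiver \<Rightarrow> 'v quiver" where
  "mutable_subquiver Q = full_subquiver Q (mutables Q)"

definition signed_arrows :: "('v, 'z) quiver_scheme \<Rightarrow> 'v \<Rightarrow> 'v \<Rightarrow> int" where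
  "signed_arrows Q i j = int (arrows Q i j) - int (arrows Q j i)"


definition add_paths :: "'v \<Rightarrow> ('v, 'z) quiver_scheme \<Rightarrow> ('v, 'z) quiver_scheme" where
  "add_paths k Q = Q\<lparr>arrows := (\<lambda>a b. arrows Q a b + arrows Q a k * arrows Q k b)\<rparr>"

definition reverse_at :: "'v \<Rightarrow> ('v, 'z) quiver_scheme \<Rightarrow> ('v, 'z) quiver_scheme" where
  "reverse_at k Q =
     Q\<lparr>arrows := (\<lambda>a b. if a = k \<or> b = k then arrows Q b a else arrows Q a b)\<rparr>"

text \<open>
  Removing a maximal collection of disjoint 2-cycles; the subtraction is the truncated one on
  natural numbers.
\<close>

definition remove_2cycles :: "('v, 'z) quiver_scheme \<Rightarrow> ('v, 'z) quiver_scheme" where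
  "remove_2cycles Q = Q\<lparr>arrows := (\<lambda>a b. arrows Q a b - arrows Q b a)\<rparr>"

definition mutate :: "'v \<Rightarrow> ('v, 'z) quiver_scheme \<Rightarrow> ('v, 'z) quiver_scheme" where
  "mutate k Q = remove_2cycles (reverse_at k (add_paths k Q))"

definition mutate_seq :: "'v list \<Rightarrow> ('v, 'z) quiver_scheme \<Rightarrow> ('v, 'z) quiver_scheme" where
  "mutate_seq ks Q = fold mutate ks Q"

text \<open>
  Mutation changes neither \<open>verts\<close> nor \<open>frozen\<close>, so admissibility of a sequence can be read off the
  initial ice quiver.
\<close>

definition mutation_sequence :: "'v ice_quiver \<Rightarrow> 'v list \<Rightarrow> bool" where
  "mutation_sequence Q ks \<longleftrightarrow> set ks \<subseteq> mutables Q"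


definition green :: "'v ice_quiver \<Rightarrow> 'v \<Rightarrow> bool" where
  "green Q i \<longleftrightarrow> i \<in> mutables Q \<and>
     (\<exists>x\<in>frozen Q. arrows Q i x > 0 \<or> arrows Q x i > 0) \<and>
     (\<forall>x\<in>frozen Q. arrows Q x i = 0)"

definition red :: "'v ice_quiver \<Rightarrow> 'v \<Rightarrow> bool" where
  "red Q i \<longleftrightarrow> i \<in> mutables Q \<and>
     (\<exists>x\<in>frozen Q. arrows Q i x > 0 \<or> arrows Q x i > 0) \<and>
     (\<forall>x\<in>frozen Q. arrows Q i x = 0)"

definition strictly_sign_coherent :: "'v ice_quiver \<Rightarrow> bool" where
  "strictly_sign_coherent Q \<longleftrightarrow>
     (\<forall>ks. mutation_sequence Q ks \<longrightarrow>
        (\<forall>i\<in>mutables (mutate_seq ks Q). red (mutate_seq ks Q) i \<or> green (mutate_seq ks Q) i))"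


definition abundant :: "('v, 'z) quiver_scheme \<Rightarrow> bool" where
  "abundant Q \<longleftrightarrow>
     (\<forall>i\<in>verts Q. \<forall>j\<in>verts Q. i \<noteq> j \<longrightarrow> arrows Q i j + arrows Q j i \<ge> 2)"

definition acyclic_quiver :: "('v, 'z) quiver_scheme \<Rightarrow> bool" where
  "acyclic_quiver Q \<longleftrightarrow> acyclic {(i, j). arrows Q i j > 0}"

definition in_nbrs :: "('v, 'z) quiver_scheme \<Rightarrow> 'v \<Rightarrow> 'v set" where
  "in_nbrs Q r = {i \<in> verts Q. arrows Q i r > 0}"

definition out_nbrs :: "('v, 'z) quiver_scheme \<Rightarrow> 'v \<Rightarrow> 'v set" where
  "out_nbrs Q r = {j \<in> verts Q. arrows Q r j > 0}"

definition point_of_return :: "('v, 'z) quiver_scheme \<Rightarrow> 'v \<Rightarrow> bool" where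
  "point_of_return Q r \<longleftrightarrow>
     r \<in> verts Q \<and>
     (\<forall>i\<in>in_nbrs Q r. \<forall>j\<in>out_nbrs Q r.
        signed_arrows Q j i > signed_arrows Q i r \<and>
        signed_arrows Q j i > signed_arrows Q r j) \<and>
     acyclic_quiver (full_subquiver Q (verts Q - {r}))"

definition fork :: "('v, 'z) quiver_scheme \<Rightarrow> bool" where
  "fork Q \<longleftrightarrow>
     is_quiver Q \<and> abundant Q \<and> \<not> acyclic_quiver Q \<and> (\<exists>r. point_of_return Q r)"

end

(* By sign-coherence each mutable vertex has a nonzero integer weight, the sum of its arrows to
   the frozen vertices, negative for red vertices. Consider forks whose point of return w has a
   single out-neighbour k. Mutating at the source u of the remaining vertices y gives a fork of the
   same kind with u in the role of w; if u is green only the weight of k (and u) changes, and if u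
   is red the weights of all vertices other than k decrease by at least twice the weight of u. If w
   is red, mutating once at each y thus leaves w red and dominating: mutating at w then makes all
   other vertices except possibly k red, and k, if green, can be mutated without affecting any of
   them but w. If w is green, one or two mutations at k and w lead back to the case of a red point
   of return. A general fork is brought to this kind by mutating at the source of the complement of
   its point of return. *)

theory Submission imports Defs begin

section \<open>Mutation in terms of arrow counts\<close>

lemma verts_mutate [simp]: "verts (mutate k Q) = verts Q"
  by (simp add: mutate_def remove_2cycles_def reverse_at_def add_paths_def)

lemma frozen_mutate [simp]: "frozen (mutate k Q) = frozen Q"
  by (simp add: mutate_def remove_2cycles_def reverse_at_def add_paths_def)

lemma mutables_mutate [simp]: "mutables (mutate k Q) = mutables Q"
  by (simp add: mutables_def)

text \<open>Without loops and 2-cycles, adding paths through \<open>k\<close> leaves the arrows at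
  \<open>k\<close> alone, and cancelling 2-cycles there has nothing to remove; away from
  \<open>k\<close> the truncated difference does the cancelling.\<close>

lemma arrows_mutate:
  assumes "is_quiver Q"
  shows "arrows (mutate k Q) i j =
    (if i = k \<or> j = k then arrows Q j i
     else (arrows Q i j + arrows Q i k * arrows Q k j)
        - (arrows Q j i + arrows Q j k * arrows Q k i))"
proof -
  have "arrows Q x x = 0" for x
    using assms by (simp add: is_quiver_def)
  moreover have "arrows Q x y - arrows Q y x = arrows Q x y" for x y
  proof -
    have "arrows Q x y = 0 \<or> arrows Q y x = 0"
      using assms by (auto simp: is_quiver_def)
    then show ?thesis by auto
  qed
  ultimately show ?thesis
    by (auto simp: mutate_def remove_2cycles_def reverse_at_def add_paths_def)
qed

lemma is_quiver_mutate:
  assumes "is_quiver Q"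
  shows "is_quiver (mutate k Q)"
proof -
  have "i \<in> verts Q \<and> j \<in> verts Q" if "arrows (mutate k Q) i j > 0" for i j
  proof -
    have "arrows Q i j > 0 \<or> arrows Q j i > 0 \<or> (arrows Q i k > 0 \<and> arrows Q k j > 0)"
      using that by (auto simp: arrows_mutate[OF assms] intro!: gr0I split: if_splits)
    then show ?thesis
      using assms unfolding is_quiver_def by blast
  qed
  moreover have "\<not> (arrows (mutate k Q) i j > 0 \<and> arrows (mutate k Q) j i > 0)" for i j
    using assms by (auto simp: arrows_mutate[OF assms] is_quiver_def)
  moreover have "arrows (mutate k Q) i i = 0" for i
    using assms by (auto simp: arrows_mutate[OF assms] is_quiver_def)
  ultimately show ?thesis
    using assms by (auto simp: is_quiver_def)
qed

lemma is_ice_quiver_mutate: "is_ice_quiver Q \<Longrightarrow> is_ice_quiver (mutate k Q)"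
  by (simp add: is_ice_quiver_def is_quiver_mutate)

lemma strictly_sign_coherent_mutate:
  assumes "strictly_sign_coherent Q" "k \<in> mutables Q"
  shows "strictly_sign_coherent (mutate k Q)"
  unfolding strictly_sign_coherent_def
proof (intro allI impI)
  fix ks assume "mutation_sequence (mutate k Q) ks"
  then have "mutation_sequence Q (k # ks)"
    using assms by (simp add: mutation_sequence_def)
  then show "\<forall>i\<in>mutables (mutate_seq ks (mutate k Q)).
      red (mutate_seq ks (mutate k Q)) i \<or> green (mutate_seq ks (mutate k Q)) i"
    using assms unfolding strictly_sign_coherent_def mutate_seq_def
    by (metis fold_simps(2))
qed

text \<open>One of the two opposite counts is zero, so the signed count determines both.\<close>

lemma int_arrows_eq:
  assumes "is_quiver Q"
  shows "int (arrows Q i j) = max 0 (signed_arrows Q i j)"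
proof -
  have "arrows Q i j = 0 \<or> arrows Q j i = 0"
    using assms by (auto simp: is_quiver_def)
  then show ?thesis by (auto simp: signed_arrows_def)
qed

lemma signed_arrows_swap: "signed_arrows Q j i = - signed_arrows Q i j"
  by (simp add: signed_arrows_def)

text \<open>This is matrix mutation of the signed adjacency matrix: the truncated differences for
  the two directions recombine into an ordinary integer difference.\<close>

lemma signed_arrows_mutate:
  assumes "is_quiver Q"
  shows "signed_arrows (mutate k Q) i j =
    (if i = k \<or> j = k then - signed_arrows Q i j
     else signed_arrows Q i j
        + max 0 (signed_arrows Q i k) * max 0 (signed_arrows Q k j)
        - max 0 (signed_arrows Q j k) * max 0 (signed_arrows Q k i))"
proof -
  have diff: "int (a - b) - int (b - a) = int a - int b" for a b :: nat by simp
  show ?thesis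
    unfolding int_arrows_eq[OF assms, symmetric]
    by (auto simp: signed_arrows_def arrows_mutate[OF assms] diff)
qed

section \<open>Weights of mutable vertices and their mutation\<close>

text \<open>At a red or green vertex the summands never have opposite signs, so nothing cancels and
  the sign of the sum records the colour.\<close>

definition frozen_weight :: "'v ice_quiver \<Rightarrow> 'v \<Rightarrow> int" where
  "frozen_weight Q i = (\<Sum>x\<in>frozen Q. signed_arrows Q i x)"

lemma finite_frozen: "is_ice_quiver Q \<Longrightarrow> finite (frozen Q)"
  by (auto simp: is_ice_quiver_def is_quiver_def intro: finite_subset)

lemma frozen_weight_green:
  assumes "is_ice_quiver Q" "green Q i"
  shows "frozen_weight Q i > 0"
proof -
  obtain x where x: "x \<in> frozen Q" "arrows Q i x > 0"
    using assms by (auto simp: green_def)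
  have z: "\<forall>x\<in>frozen Q. arrows Q x i = 0"
    using assms by (auto simp: green_def)
  show ?thesis unfolding frozen_weight_def
    using x z by (intro sum_pos2[OF finite_frozen[OF assms(1)]]) (auto simp: signed_arrows_def)
qed

lemma frozen_weight_red:
  assumes "is_ice_quiver Q" "red Q i"
  shows "frozen_weight Q i < 0"
proof -
  obtain x where x: "x \<in> frozen Q" "arrows Q x i > 0"
    using assms by (auto simp: red_def)
  have z: "\<forall>x\<in>frozen Q. arrows Q i x = 0"
    using assms by (auto simp: red_def)
  have "(\<Sum>x\<in>frozen Q. - signed_arrows Q i x) > 0"
    using x z by (intro sum_pos2[OF finite_frozen[OF assms(1)]]) (auto simp: signed_arrows_def)
  then show ?thesis by (simp add: frozen_weight_def sum_negf)
qed

lemma red_or_green: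
  assumes "strictly_sign_coherent Q" "i \<in> mutables Q"
  shows "red Q i \<or> green Q i"
proof -
  have "mutation_sequence Q []" by (simp add: mutation_sequence_def)
  then show ?thesis
    using assms unfolding strictly_sign_coherent_def mutate_seq_def
    by (metis fold_simps(1))
qed

lemma frozen_weight_nonzero:
  assumes "is_ice_quiver Q" "strictly_sign_coherent Q" "i \<in> mutables Q"
  shows "frozen_weight Q i \<noteq> 0"
  using red_or_green[OF assms(2,3)] frozen_weight_red[OF assms(1), of i]
    frozen_weight_green[OF assms(1), of i] by auto

lemma red_if_frozen_weight_neg:
  assumes "is_ice_quiver Q" "strictly_sign_coherent Q" "i \<in> mutables Q" "frozen_weight Q i < 0"
  shows "red Q i"
  using red_or_green[OF assms(2,3)] frozen_weight_green[OF assms(1), of i] assms(4) by auto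

lemma frozen_weight_mutate_same:
  assumes "is_ice_quiver Q"
  shows "frozen_weight (mutate k Q) k = - frozen_weight Q k"
  using assms by (simp add: frozen_weight_def is_ice_quiver_def signed_arrows_mutate sum_negf)

text \<open>By sign-coherence, the frozen vertices can be merged into one without changing the mutation rule.\<close>

lemma frozen_weight_mutate:
  assumes Q: "is_ice_quiver Q" "strictly_sign_coherent Q" and k: "k \<in> mutables Q" and i: "i \<noteq> k"
  shows "frozen_weight (mutate k Q) i = frozen_weight Q i +
    (if frozen_weight Q k > 0 then max 0 (signed_arrows Q i k) else max 0 (signed_arrows Q k i))
      * frozen_weight Q k"
proof -
  have q: "is_quiver Q" using Q by (simp add: is_ice_quiver_def)
  let ?d = "\<lambda>x. signed_arrows Q k x"
  have neq: "x \<noteq> k" if "x \<in> frozen Q" for x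
    using that k by (auto simp: mutables_def)
  have eq: "frozen_weight (mutate k Q) i = (\<Sum>x\<in>frozen Q. signed_arrows Q i x
      + max 0 (signed_arrows Q i k) * max 0 (?d x)
      - max 0 (- ?d x) * max 0 (signed_arrows Q k i))"
    unfolding frozen_weight_def frozen_mutate
    by (rule sum.cong)
      (use i neq in \<open>auto simp: signed_arrows_mutate[OF q] signed_arrows_swap[of Q k]\<close>)
  show ?thesis
  proof (cases "frozen_weight Q k > 0")
    case True
    then have "green Q k"
      using red_or_green[OF Q(2) k] frozen_weight_red[OF Q(1), of k] by auto
    \<comment> \<open>All arrows between \<open>k\<close> and frozen vertices have the same
      direction, so one of the two products vanishes and the other is linear in \<open>?d x\<close>;
      the sum then factors. The red case is symmetric.\<close>
    then have "?d x \<ge> 0" if "x \<in> frozen Q" for x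
      using that by (auto simp: green_def signed_arrows_def)
    then have "frozen_weight (mutate k Q) i = (\<Sum>x\<in>frozen Q. signed_arrows Q i x
        + max 0 (signed_arrows Q i k) * ?d x)"
      unfolding eq by (intro sum.cong) auto
    with True show ?thesis
      by (simp add: frozen_weight_def sum.distrib sum_distrib_left)
  next
    case False
    then have "red Q k"
      using red_or_green[OF Q(2) k] frozen_weight_green[OF Q(1), of k] by auto
    then have "?d x \<le> 0" if "x \<in> frozen Q" for x
      using that by (auto simp: red_def signed_arrows_def)
    then have "frozen_weight (mutate k Q) i = (\<Sum>x\<in>frozen Q. signed_arrows Q i x
        + max 0 (signed_arrows Q k i) * ?d x)"
      unfolding eq by (intro sum.cong) auto
    with False show ?thesis
      by (simp add: frozen_weight_def sum.distrib sum_distrib_left)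
  qed
qed

section \<open>Cyclic forks and their mutations\<close>

text \<open>
  A fork with point of return \<open>w\<close> whose only out-neighbour is \<open>k\<close>, while \<open>k # ys\<close> lists the other
  mutable vertices along the arrows.
\<close>

definition cyclic_fork :: "'v ice_quiver \<Rightarrow> 'v \<Rightarrow> 'v list \<Rightarrow> 'v \<Rightarrow> bool" where
  "cyclic_fork Q k ys w \<longleftrightarrow>
     is_ice_quiver Q \<and> strictly_sign_coherent Q \<and>
     distinct (k # w # ys) \<and> set (k # w # ys) = mutables Q \<and> ys \<noteq> [] \<and>
     sorted_wrt (\<lambda>x y. 2 \<le> signed_arrows Q x y) ys \<and>
     2 \<le> signed_arrows Q w k \<and>
     (\<forall>y\<in>set ys. 2 \<le> signed_arrows Q y w \<and>
        signed_arrows Q y w < signed_arrows Q k y \<and> signed_arrows Q w k < signed_arrows Q k y)"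

lemma cyclic_forkD:
  assumes "cyclic_fork Q k ys w"
  shows "is_ice_quiver Q" "is_quiver Q" "strictly_sign_coherent Q"
    "distinct (k # w # ys)" "mutables Q = insert k (insert w (set ys))" "ys \<noteq> []"
    "sorted_wrt (\<lambda>x y. 2 \<le> signed_arrows Q x y) ys" "2 \<le> signed_arrows Q w k"
    "\<And>y. y \<in> set ys \<Longrightarrow> 2 \<le> signed_arrows Q y w"
    "\<And>y. y \<in> set ys \<Longrightarrow> signed_arrows Q y w < signed_arrows Q k y"
    "\<And>y. y \<in> set ys \<Longrightarrow> signed_arrows Q w k < signed_arrows Q k y"
  using assms by (auto simp: cyclic_fork_def is_ice_quiver_def)

lemma mult_ge_twice: "2 \<le> a \<Longrightarrow> 0 \<le> b \<Longrightarrow> 2 * b \<le> a * (b::int)"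
  by (intro mult_right_mono)

lemma mult_ge_twice': "2 \<le> b \<Longrightarrow> 0 \<le> a \<Longrightarrow> 2 * a \<le> a * (b::int)"
  using mult_ge_twice[of b a] by (simp only: mult.commute[of a b])

text \<open>Only \<open>k\<close> has arrows to \<open>u\<close>, so every path through
  \<open>u\<close> starts at \<open>k\<close> and only arrows between \<open>k\<close> and the other
  vertices are added. The old point of return \<open>w\<close> becomes the last vertex of the
  list.\<close>

lemma cyclic_fork_mutate_source:
  assumes "cyclic_fork Q k (u # ys) w"
  shows "cyclic_fork (mutate u Q) k (ys @ [w]) u"
proof -
  note D = cyclic_forkD[OF assms]
  note M = signed_arrows_mutate[OF D(2)]
  have uy: "2 \<le> signed_arrows Q u y" if "y \<in> set ys" for y using D(7) that by auto
  have uw: "2 \<le> signed_arrows Q u w" "signed_arrows Q u w < signed_arrows Q k u"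
    "signed_arrows Q w k < signed_arrows Q k u" using D(9-11) by auto
  have same: "signed_arrows (mutate u Q) x y = signed_arrows Q x y"
    if "x \<in> insert w (set ys)" "y \<in> insert w (set ys)" for x y
  proof -
    have "x \<noteq> u" "y \<noteq> u" using that D(4) by auto
    moreover have "signed_arrows Q x u \<le> 0" "signed_arrows Q y u \<le> 0"
      using that uy uw(1) by (auto simp: signed_arrows_swap[of Q _ u] dest!: uy)
    ultimately show ?thesis by (simp add: M)
  qed
  have ku: "signed_arrows (mutate u Q) u k = signed_arrows Q k u" by (simp add: M signed_arrows_swap[of Q u])
  have yu: "signed_arrows (mutate u Q) y u = signed_arrows Q u y" for y
    by (simp add: M signed_arrows_swap[of Q u])
  have kx: "signed_arrows (mutate u Q) k y = signed_arrows Q k y + signed_arrows Q k u * signed_arrows Q u y"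
    if "y \<in> insert w (set ys)" for y
  proof -
    have "y \<noteq> u" "k \<noteq> u" using that D(4) by auto
    moreover have "2 \<le> signed_arrows Q u y" using that uy uw by auto
    ultimately show ?thesis using uw by (simp add: M signed_arrows_swap[of Q u])
  qed
  have sorted: "sorted_wrt (\<lambda>x y. 2 \<le> signed_arrows (mutate u Q) x y) (ys @ [w])"
  proof -
    have "sorted_wrt (\<lambda>x y. 2 \<le> signed_arrows Q x y) (ys @ [w])"
      using D(7,9) by (simp add: sorted_wrt_append)
    then show ?thesis using same by (auto intro: sorted_wrt_mono_rel[rotated])
  qed
  have "2 \<le> signed_arrows Q u y \<and> signed_arrows Q u y < signed_arrows (mutate u Q) k y \<and>
      signed_arrows Q k u < signed_arrows (mutate u Q) k y" if "y \<in> set ys" for y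
  proof -
    have a: "2 \<le> signed_arrows Q u y" "2 \<le> signed_arrows Q k u" "signed_arrows Q k y > 0"
      using uy[OF that] uw D(8) D(11)[of y] that by auto
    have "2 * signed_arrows Q u y \<le> signed_arrows Q k u * signed_arrows Q u y"
      "2 * signed_arrows Q k u \<le> signed_arrows Q k u * signed_arrows Q u y"
      using a by (intro mult_ge_twice mult_ge_twice'; simp)+
    moreover have "signed_arrows (mutate u Q) k y
        = signed_arrows Q k y + signed_arrows Q k u * signed_arrows Q u y"
      using kx[of y] that by simp
    ultimately show ?thesis using a by - (intro conjI; linarith)
  qed
  \<comment> \<open>The arrows \<open>w\<close> to \<open>k\<close> get reversed: the added paths
    are at least twice the arrows \<open>k\<close> to \<open>u\<close>, and these already outnumber
    the arrows \<open>w\<close> to \<open>k\<close>.\<close>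
  moreover have "signed_arrows Q u w < signed_arrows (mutate u Q) k w \<and>
      signed_arrows Q k u < signed_arrows (mutate u Q) k w"
  proof -
    have "2 * signed_arrows Q k u \<le> signed_arrows Q k u * signed_arrows Q u w"
      using uw by (intro mult_ge_twice') auto
    moreover have "signed_arrows (mutate u Q) k w
        = - signed_arrows Q w k + signed_arrows Q k u * signed_arrows Q u w"
      using kx[of w] by (simp add: signed_arrows_swap[of Q k w])
    ultimately show ?thesis using uw by - (intro conjI; linarith)
  qed
  ultimately show ?thesis
    using D(1,3,4,5) uw sorted ku yu
    by (auto simp: cyclic_fork_def is_ice_quiver_mutate strictly_sign_coherent_mutate)
qed

text \<open>All paths through \<open>k\<close> start at \<open>w\<close> and end in
  \<open>ys\<close>. They number at least twice the arrows from \<open>k\<close> to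
  \<open>y\<close>, which exceed the arrows from \<open>y\<close> to \<open>w\<close>; so
  \<open>w\<close> now points to all of \<open>ys\<close>, and \<open>k\<close> and \<open>w\<close>
  swap roles.\<close>

lemma cyclic_fork_mutate_first:
  assumes "cyclic_fork Q k ys w"
  shows "cyclic_fork (mutate k Q) w ys k"
proof -
  note D = cyclic_forkD[OF assms]
  note M = signed_arrows_mutate[OF D(2)]
  have ky: "2 < signed_arrows Q k y" if "y \<in> set ys" for y using D(9,10)[OF that] by simp
  have same: "signed_arrows (mutate k Q) x y = signed_arrows Q x y"
    if "x \<in> set ys" "y \<in> set ys" for x y
    using that D(4) ky[of x] ky[of y] by (auto simp: M signed_arrows_swap[of Q k])
  have sorted: "sorted_wrt (\<lambda>x y. 2 \<le> signed_arrows (mutate k Q) x y) ys"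
    using D(7) same by (auto intro: sorted_wrt_mono_rel[rotated])
  have "signed_arrows Q k y < signed_arrows (mutate k Q) w y \<and>
      signed_arrows Q w k < signed_arrows (mutate k Q) w y" if "y \<in> set ys" for y
  proof -
    have "signed_arrows (mutate k Q) w y = - signed_arrows Q y w + signed_arrows Q w k * signed_arrows Q k y"
    proof -
      have "w \<noteq> k" "y \<noteq> k" using that D(4) by auto
      then show ?thesis
        using D(8) ky[OF that] signed_arrows_swap[of Q w y] signed_arrows_swap[of Q y k]
        by (simp add: M)
    qed
    moreover have "2 * signed_arrows Q k y \<le> signed_arrows Q w k * signed_arrows Q k y"
      using D(8) ky[OF that] by (intro mult_ge_twice) auto
    ultimately show ?thesis using D(10,11)[OF that] by simp
  qed
  moreover have "2 \<le> signed_arrows (mutate k Q) k w"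
    using D(8) by (simp add: M signed_arrows_swap[of Q k])
  moreover have "2 \<le> signed_arrows (mutate k Q) y k"
    "signed_arrows (mutate k Q) y k = signed_arrows Q k y" if "y \<in> set ys" for y
    using ky[OF that] by (simp_all add: M signed_arrows_swap[of Q k])
  moreover have "signed_arrows (mutate k Q) k w = signed_arrows Q w k" 
    by (simp_all add: M signed_arrows_swap[of Q k])
  ultimately show ?thesis
    using D(1,3,4,5,6) sorted
    by (auto simp: cyclic_fork_def is_ice_quiver_mutate strictly_sign_coherent_mutate)
qed


section \<open>Weights in cyclic forks\<close>

text \<open>Mutating a green vertex affects, besides itself, only its in-neighbours; mutating a red
  one only its out-neighbours. Here \<open>w\<close> and \<open>ys\<close> are out-neighbours of
  \<open>u\<close>, each by at least two arrows.\<close>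

lemma frozen_weight_mutate_source:
  assumes "cyclic_fork Q k (u # ys) w"
  shows "frozen_weight Q u > 0 \<Longrightarrow> y \<in> insert w (set ys) \<Longrightarrow>
      frozen_weight (mutate u Q) y = frozen_weight Q y"
    and "frozen_weight Q u < 0 \<Longrightarrow> y \<in> insert w (set ys) \<Longrightarrow>
      frozen_weight (mutate u Q) y \<le> frozen_weight Q y + 2 * frozen_weight Q u"
proof -
  note D = cyclic_forkD[OF assms]
  have u: "u \<in> mutables Q" using D(5) by simp
  show "frozen_weight (mutate u Q) y = frozen_weight Q y"
    if "frozen_weight Q u > 0" "y \<in> insert w (set ys)"
  proof -
    have "y \<noteq> u" "2 \<le> signed_arrows Q u y" using that D(4,7,9) by auto
    then show ?thesis
      using frozen_weight_mutate[OF D(1,3) u, of y] that by (simp add: signed_arrows_swap[of Q u])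
  qed
  show "frozen_weight (mutate u Q) y \<le> frozen_weight Q y + 2 * frozen_weight Q u"
    if "frozen_weight Q u < 0" "y \<in> insert w (set ys)"
  proof -
    have y: "y \<noteq> u" "2 \<le> signed_arrows Q u y" using that D(4,7,9) by auto
    have "signed_arrows Q u y * frozen_weight Q u \<le> 2 * frozen_weight Q u"
      using y that by (intro mult_right_mono_neg) auto
    then show ?thesis
      using frozen_weight_mutate[OF D(1,3) u, of y] that y by simp
  qed
qed

text \<open>The same principle at \<open>k\<close>, whose out-neighbours are \<open>ys\<close> and
  whose only in-neighbour is \<open>w\<close>.\<close>

lemma frozen_weight_mutate_first:
  assumes "cyclic_fork Q k ys w"
  shows "frozen_weight Q k > 0 \<Longrightarrow> y \<in> set ys \<Longrightarrow>
      frozen_weight (mutate k Q) y = frozen_weight Q y"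
    and "frozen_weight Q k < 0 \<Longrightarrow> frozen_weight (mutate k Q) w = frozen_weight Q w"
proof -
  note D = cyclic_forkD[OF assms]
  have k: "k \<in> mutables Q" using D(5) by simp
  show "frozen_weight (mutate k Q) y = frozen_weight Q y"
    if "frozen_weight Q k > 0" "y \<in> set ys"
  proof -
    have "y \<noteq> k" "2 < signed_arrows Q k y" using that D(4) D(9,10)[of y] by auto
    then show ?thesis
      using frozen_weight_mutate[OF D(1,3) k, of y] that by (simp add: signed_arrows_swap[of Q k])
  qed
  show "frozen_weight (mutate k Q) w = frozen_weight Q w" if "frozen_weight Q k < 0"
  proof -
    have "w \<noteq> k" using D(4) by auto
    then show ?thesis
      using frozen_weight_mutate[OF D(1,3) k, of w] that D(8) signed_arrows_swap[of Q k w] by simp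
  qed
qed

section \<open>Cyclic forks are forks\<close>

text \<open>The list is a topological order: its head has no incoming edges, so any cycle would lie
  in the tail.\<close>

lemma acyclic_if_sorted_wrt:
  assumes "sorted_wrt (\<lambda>x y. (y, x) \<notin> E) xs" "\<And>x. (x, x) \<notin> E" "E \<subseteq> set xs \<times> set xs"
  shows "acyclic E"
  using assms
proof (induction xs arbitrary: E)
  case Nil
  then show ?case by (simp add: acyclic_def)
next
  case (Cons a xs)
  let ?A = "E \<inter> set xs \<times> set xs"
  have "acyclic ?A"
    using Cons.prems by (intro Cons.IH) (auto intro: sorted_wrt_mono_rel[rotated])
  moreover have no_in: "(x, a) \<notin> E" for x
    using Cons.prems by auto
  \<comment> \<open>A path that does not start at \<open>a\<close> can never reach it, so it uses
    only edges of the tail.\<close>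
  have "(x, y) \<in> ?A\<^sup>+" if "(x, y) \<in> E\<^sup>+" "x \<noteq> a" for x y
    using that
  proof (induction rule: trancl_induct)
    case (base y)
    then show ?case using Cons.prems(3) no_in by auto
  next
    case (step y z)
    have "y \<noteq> a" using step.hyps(1) no_in by (metis tranclD2)
    then have "(y, z) \<in> ?A" using step.hyps(2) Cons.prems(3) no_in by auto
    then show ?case using step by (metis trancl.trancl_into_trancl)
  qed
  moreover have "(a, a) \<notin> E\<^sup>+" using no_in by (metis tranclD2)
  ultimately show ?case unfolding acyclic_def by metis
qed

lemma fork_mutable_subquiver_if_cyclic_fork:
  assumes "cyclic_fork Q k ys w"
  shows "fork (mutable_subquiver Q)"
proof -
  note D = cyclic_forkD[OF assms]
  let ?S = "mutable_subquiver Q"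
  have v: "verts ?S = insert k (insert w (set ys))"
    using D(5) by (auto simp: mutable_subquiver_def full_subquiver_def mutables_def)
  have a: "arrows ?S i j = (if i \<in> verts ?S \<and> j \<in> verts ?S then arrows Q i j else 0)" for i j
    by (simp add: mutable_subquiver_def full_subquiver_def)
  have pos: "arrows Q i j > 0 \<longleftrightarrow> signed_arrows Q i j > 0" for i j
    using int_arrows_eq[OF D(2), of i j] by linarith
  have ge2: "arrows Q i j \<ge> 2" if "signed_arrows Q i j \<ge> 2" for i j
    using int_arrows_eq[OF D(2), of i j] that by linarith
  have ky: "signed_arrows Q k y > 2" if "y \<in> set ys" for y
    using D(9,10)[OF that] by simp
  have q: "is_quiver ?S"
    using D(2) by (auto simp: is_quiver_def a v)
  have ab_ys: "2 \<le> arrows Q x y + arrows Q y x" if "x \<in> set ys" "y \<in> set ys" "x \<noteq> y" for x y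
  proof -
    have "2 \<le> signed_arrows Q x y \<or> 2 \<le> signed_arrows Q y x"
      using D(7) that by (induction ys) auto
    then show ?thesis using ge2 by fastforce
  qed
  have "2 \<le> arrows Q w k" using D(8) ge2 by simp
  moreover have "2 \<le> arrows Q y w" "2 \<le> arrows Q k y" if "y \<in> set ys" for y
    using ge2 D(9)[OF that] ky[OF that] by auto
  ultimately have ab: "abundant ?S"
    using ab_ys by (auto simp: abundant_def a v) (force simp: trans_le_add1 trans_le_add2)+
  obtain y where y: "y \<in> set ys" using D(6) by (cases ys) auto
  \<comment> \<open>Any \<open>y\<close> in \<open>ys\<close> closes the 3-cycle from
    \<open>w\<close> to \<open>k\<close> to \<open>y\<close> and back to \<open>w\<close>.\<close>
  have "(w, k) \<in> {(i, j). arrows ?S i j > 0}" "(k, y) \<in> {(i, j). arrows ?S i j > 0}"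
    "(y, w) \<in> {(i, j). arrows ?S i j > 0}"
    using D(8) ky[OF y] D(9)[OF y] y by (auto simp: a v pos)
  then have "(w, w) \<in> {(i, j). arrows ?S i j > 0}\<^sup>+"
    by (meson trancl.simps)
  then have nac: "\<not> acyclic_quiver ?S"
    by (auto simp: acyclic_quiver_def acyclic_def)
  have in_w: "in_nbrs ?S w \<subseteq> set ys"
    using D(8) by (auto simp: in_nbrs_def a v pos signed_arrows_swap[of Q k w] signed_arrows_def)
  have out_w: "out_nbrs ?S w \<subseteq> {k}"
    using D(9) by (fastforce simp: out_nbrs_def a v pos signed_arrows_def)
  have sa: "signed_arrows ?S i j = signed_arrows Q i j" if "i \<in> verts ?S" "j \<in> verts ?S" for i j
    using that by (simp add: signed_arrows_def a)
  have zero: "arrows Q j i = 0" if "signed_arrows Q i j \<ge> 2" for i j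
    using int_arrows_eq[OF D(2), of j i] signed_arrows_swap[of Q j i] that by simp
  \<comment> \<open>The list \<open>k # ys\<close> is a topological order of the complement of
    \<open>w\<close>.\<close>
  have "sorted_wrt (\<lambda>x y. 2 \<le> signed_arrows Q x y) (k # ys)"
    using D(7) ky by (auto intro: less_imp_le)
  then have "sorted_wrt (\<lambda>x y. arrows Q y x = 0) (k # ys)"
    by (rule sorted_wrt_mono_rel[rotated]) (rule zero)
  then have ac: "acyclic_quiver (full_subquiver ?S (verts ?S - {w}))"
    unfolding acyclic_quiver_def
    using q by (intro acyclic_if_sorted_wrt[of _ "k # ys"])
      (auto simp: full_subquiver_def a v is_quiver_def split: if_splits elim!: sorted_wrt_mono_rel[rotated])
  have "point_of_return ?S w"
    unfolding point_of_return_def using in_w out_w ac D(9-11) D(4)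
    by (auto simp: sa v dest!: subsetD[OF in_w] subsetD[OF out_w])
  then show ?thesis
    using q ab nac by (auto simp: fork_def)
qed

section \<open>Reddening cyclic forks in few mutations\<close>

definition reddened :: "'v ice_quiver \<Rightarrow> bool" where
  "reddened Q \<longleftrightarrow> is_ice_quiver Q \<and> fork (mutable_subquiver Q) \<and>
     card {i. red Q i} \<ge> card (mutables Q) - 1"

definition reddenable :: "'v ice_quiver \<Rightarrow> nat \<Rightarrow> bool" where
  "reddenable Q m \<longleftrightarrow>
     (\<exists>ks. mutation_sequence Q ks \<and> length ks \<le> m \<and> reddened (mutate_seq ks Q))"

lemma reddenable_if_reddened: "reddened Q \<Longrightarrow> reddenable Q m"
  unfolding reddenable_def
  by (rule exI[of _ "[]"]) (simp add: mutation_sequence_def mutate_seq_def)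

lemma reddenable_mutate:
  assumes "reddenable (mutate k Q) m" "k \<in> mutables Q"
  shows "reddenable Q (Suc m)"
proof -
  obtain ks where "mutation_sequence (mutate k Q) ks" "length ks \<le> m"
    "reddened (mutate_seq ks (mutate k Q))"
    using assms(1) by (auto simp: reddenable_def)
  then show ?thesis
    using assms(2) unfolding reddenable_def
    by (intro exI[of _ "k # ks"]) (simp add: mutation_sequence_def mutate_seq_def)
qed

lemma reddenable_mono: "reddenable Q m \<Longrightarrow> m \<le> m' \<Longrightarrow> reddenable Q m'"
  by (auto simp: reddenable_def)

lemma reddened_if_all_but_one:
  assumes "cyclic_fork Q k ys w" "x \<in> mutables Q"
    and neg: "\<And>y. y \<in> mutables Q - {x} \<Longrightarrow> frozen_weight Q y < 0"
  shows "reddened Q"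
proof -
  note D = cyclic_forkD[OF assms(1)]
  have "mutables Q - {x} \<subseteq> {i. red Q i}"
    using red_if_frozen_weight_neg[OF D(1,3)] neg by auto
  moreover have fin: "finite (mutables Q)" using D(5) by simp
  moreover have "{i. red Q i} \<subseteq> mutables Q" by (auto simp: red_def)
  ultimately have "card (mutables Q - {x}) \<le> card {i. red Q i}"
    by (meson card_mono finite_subset)
  then show ?thesis
    using D(1) fork_mutable_subquiver_if_cyclic_fork[OF assms(1)] assms(2) fin
    by (simp add: reddened_def card_Diff_singleton)
qed

text \<open>Mutating at the red \<open>u\<close> lowers \<open>w\<close> and all of
  \<open>ys\<close> far enough to make them red. Besides \<open>u\<close>, which may stay green,
  only \<open>k\<close> can then fail to be red, and one further mutation repairs it.\<close>

lemma reddenable_dominated: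
  assumes "cyclic_fork Q k (u # ys) w" "frozen_weight Q u < 0"
    and dom: "\<And>y. y \<in> insert w (set ys) \<Longrightarrow> frozen_weight Q y + 2 * frozen_weight Q u < 0"
  shows "reddenable Q 2"
proof -
  note D = cyclic_forkD[OF assms(1)]
  let ?R = "mutate u Q"
  have C: "cyclic_fork ?R k (ys @ [w]) u" using assms(1) by (rule cyclic_fork_mutate_source)
  note E = cyclic_forkD[OF C]
  have neg: "frozen_weight ?R y < 0" if "y \<in> insert w (set ys)" for y
    using frozen_weight_mutate_source(2)[OF assms(1,2) that] dom[OF that] by simp
  have "reddenable ?R 1"
  proof (cases "frozen_weight ?R k < 0")
    case True
    then have "reddened ?R"
      using E(5) neg by (intro reddened_if_all_but_one[OF C, of u]) auto
    then show ?thesis by (rule reddenable_if_reddened)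
  next
    case False
    then have k: "frozen_weight ?R k > 0"
      using frozen_weight_nonzero[OF E(1,3), of k] E(5) by auto
    \<comment> \<open>Mutating the green \<open>k\<close> turns it red and otherwise affects only
      its in-neighbour \<open>u\<close>, the permitted exception.\<close>
    have "reddened (mutate k ?R)"
    proof (rule reddened_if_all_but_one[OF cyclic_fork_mutate_first[OF C], of u])
      show "u \<in> mutables (mutate k ?R)" using D(5) by simp
      fix y assume "y \<in> mutables (mutate k ?R) - {u}"
      then have "y = k \<or> y \<in> set (ys @ [w])" using D(5) by auto
      then show "frozen_weight (mutate k ?R) y < 0"
        using frozen_weight_mutate_same[OF E(1)] frozen_weight_mutate_first(1)[OF C k] neg k
        by auto
    qed
    then have "reddenable (mutate k ?R) 0" by (rule reddenable_if_reddened)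
    then show ?thesis using reddenable_mutate[of k ?R 0] D(5) by simp
  qed
  then show ?thesis using reddenable_mutate[of u Q 1] D(5) by (simp add: numeral_2_eq_2)
qed

text \<open>
  While the sources \<open>ys\<close> preceding a red \<open>w\<close> are mutated one after the other, a source mutated as
  a green vertex becomes red, and one mutated as a red vertex of weight \<open>-c\<close> becomes green of weight
  \<open>c\<close> but lowers \<open>w\<close> by at least \<open>2 * c\<close>. So \<open>w\<close> dominates all vertices \<open>zs\<close> mutated after it.
\<close>

lemma reddenable_lap:
  assumes "cyclic_fork Q k xs t" "xs @ [t] = ys @ w # zs" "frozen_weight Q w < 0"
    and "\<And>z. z \<in> set zs \<Longrightarrow> frozen_weight Q z + 2 * frozen_weight Q w < 0"
  shows "reddenable Q (length ys + 2)"
  using assms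
\<comment> \<open>Each mutation rotates \<open>xs @ [t]\<close> by one place: \<open>ys\<close>
  loses its head, which is appended to \<open>zs\<close> as the new point of return. Once
  \<open>ys\<close> is empty, \<open>w\<close> is the source and dominates the rest.\<close>
proof (induction ys arbitrary: Q xs t zs)
  case Nil
  note D = cyclic_forkD[OF Nil.prems(1)]
  obtain xs' where xs: "xs = w # xs'" using D(6) Nil.prems(2) by (cases xs) auto
  then have "zs = xs' @ [t]" using Nil.prems(2) by simp
  then show ?case
    using Nil.prems xs reddenable_dominated[of Q k w xs' t] by (simp add: numeral_2_eq_2)
next
  case (Cons y ys)
  note D = cyclic_forkD[OF Cons.prems(1)]
  obtain xs' where xs: "xs = y # xs'" using D(6) Cons.prems(2) by (cases xs) auto
  then have xs': "xs' @ [t] = ys @ w # zs" using Cons.prems(2) by simp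
  then have "set (xs' @ [t]) = set (ys @ w # zs)" by (rule arg_cong)
  then have sub: "insert t (set xs') = insert w (set ys \<union> set zs)" by auto
  note C = Cons.prems(1)[unfolded xs]
  have ym: "y \<in> mutables Q" using D(5) xs by simp
  have yy: "frozen_weight (mutate y Q) y = - frozen_weight Q y"
    using D(1) by (rule frozen_weight_mutate_same)
  have "frozen_weight (mutate y Q) w < 0 \<and>
    (\<forall>z\<in>set (zs @ [y]). frozen_weight (mutate y Q) z + 2 * frozen_weight (mutate y Q) w < 0)"
  proof (cases "frozen_weight Q y > 0")
    case True
    then have "frozen_weight (mutate y Q) x = frozen_weight Q x" if "x \<in> insert w (set zs)" for x
      using frozen_weight_mutate_source(1)[OF C True, of x] sub that by auto
    then show ?thesis using Cons.prems(3,4) yy True by auto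
  next
    case False
    then have neg: "frozen_weight Q y < 0" using frozen_weight_nonzero[OF D(1,3) ym] by simp
    have le: "frozen_weight (mutate y Q) x \<le> frozen_weight Q x + 2 * frozen_weight Q y"
      if "x \<in> insert w (set zs)" for x
      using frozen_weight_mutate_source(2)[OF C neg, of x] sub that by auto
    have w: "frozen_weight (mutate y Q) w \<le> frozen_weight Q w + 2 * frozen_weight Q y"
      by (rule le) simp
    \<comment> \<open>The old sum is negative, and both weights in it only decrease.\<close>
    have "frozen_weight (mutate y Q) z + 2 * frozen_weight (mutate y Q) w < 0"
      if "z \<in> set zs" for z
      using le[of z] Cons.prems(4)[OF that] w neg that by simp
    then show ?thesis using w Cons.prems(3) yy neg by auto
  qed
  then have "reddenable (mutate y Q) (length ys + 2)"
    using Cons.IH[OF cyclic_fork_mutate_source[OF C], of "zs @ [y]"] xs' by auto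
  then show ?case using reddenable_mutate[OF _ ym] by simp
qed

text \<open>The count is one mutation for each vertex of \<open>ys\<close>, one at \<open>w\<close>
  and at most one at \<open>k\<close>.\<close>

lemma reddenable_if_return_red:
  assumes "cyclic_fork Q k ys w" "frozen_weight Q w < 0"
  shows "reddenable Q (card (mutables Q))"
proof -
  note D = cyclic_forkD[OF assms(1)]
  have "card (mutables Q) = length ys + 2"
    using D(4,5) by (simp add: distinct_card)
  then show ?thesis
    \<comment> \<open>Nothing lies behind \<open>w\<close> at the start, so domination holds
      vacuously.\<close>
    using reddenable_lap[OF assms(1), of ys w "[]"] assms(2) by simp
qed

text \<open>Mutating the green \<open>k\<close> makes it a red point of return.\<close>

lemma reddenable_if_first_green:
  assumes "cyclic_fork Q k ys w" "frozen_weight Q k > 0"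
  shows "reddenable Q (Suc (card (mutables Q)))"
proof -
  note D = cyclic_forkD[OF assms(1)]
  have "reddenable (mutate k Q) (card (mutables (mutate k Q)))"
    using cyclic_fork_mutate_first[OF assms(1)] assms(2)
    by (intro reddenable_if_return_red) (auto simp: frozen_weight_mutate_same[OF D(1)])
  then show ?thesis using reddenable_mutate[of k Q] D(5) by simp
qed

lemma reddenable_cyclic_fork:
  assumes "cyclic_fork Q k ys w"
  shows "reddenable Q (card (mutables Q) + 2)"
proof -
  note D = cyclic_forkD[OF assms]
  have km: "k \<in> mutables Q" and wm: "w \<in> mutables Q" using D(5) by auto
  consider "frozen_weight Q w < 0" | "frozen_weight Q k > 0"
    | "frozen_weight Q w > 0" "frozen_weight Q k < 0"
    using frozen_weight_nonzero[OF D(1,3) km] frozen_weight_nonzero[OF D(1,3) wm] by linarith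
  then show ?thesis
  proof cases
    case 1
    then show ?thesis using reddenable_if_return_red[OF assms] by (auto intro: reddenable_mono)
  next
    case 2
    then show ?thesis using reddenable_if_first_green[OF assms] by (auto intro: reddenable_mono)
  next
    case 3
    \<comment> \<open>Mutating the red \<open>k\<close> leaves the weight of its in-neighbour
      \<open>w\<close> unchanged, and \<open>w\<close> becomes the first vertex, still
      green.\<close>
    then have "reddenable (mutate k Q) (Suc (card (mutables (mutate k Q))))"
      using frozen_weight_mutate_first(2)[OF assms]
      by (intro reddenable_if_first_green[OF cyclic_fork_mutate_first[OF assms]]) simp
    then show ?thesis using reddenable_mutate[OF _ km] by simp
  qed
qed


section \<open>From arbitrary forks to cyclic forks\<close>

text \<open>A minimal element precedes every other one by comparability; remove it and
  repeat.\<close>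

lemma exists_topological_sorting:
  assumes "finite A" "wf E" "\<And>x y. x \<in> A \<Longrightarrow> y \<in> A \<Longrightarrow> x \<noteq> y \<Longrightarrow> (x, y) \<in> E \<or> (y, x) \<in> E"
  shows "\<exists>xs. distinct xs \<and> set xs = A \<and> sorted_wrt (\<lambda>x y. (x, y) \<in> E) xs"
  using assms(1,3)
proof (induction A rule: finite_psubset_induct)
  case (psubset A)
  show ?case
  proof (cases "A = {}")
    case False
    then obtain z where z: "z \<in> A" "\<And>y. (y, z) \<in> E \<Longrightarrow> y \<notin> A"
      using wfE_min[OF assms(2)] by (metis ex_in_conv)
    obtain xs where "distinct xs" "set xs = A - {z}" "sorted_wrt (\<lambda>x y. (x, y) \<in> E) xs"
      using psubset.IH[of "A - {z}"] psubset.prems z(1) by auto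
    moreover have "(z, y) \<in> E" if "y \<in> A - {z}" for y
      using psubset.prems[of z y] z that by auto
    ultimately show ?thesis
      using z(1) by (intro exI[of _ "z # xs"]) auto
  qed simp
qed

text \<open>The vertex \<open>v\<close> is the source of the complement of the point of return
  \<open>r\<close>. It receives arrows from \<open>r\<close> alone, so mutating there makes
  \<open>r\<close> the only out-neighbour of \<open>v\<close> and sends enough new arrows from
  \<open>r\<close> to all other vertices.\<close>

lemma fork_mutate_to_cyclic_fork:
  assumes F: "is_ice_quiver F" "strictly_sign_coherent F" "fork (mutable_subquiver F)"
  obtains v k ys where "v \<in> mutables F" "cyclic_fork (mutate v F) k ys v"
proof -
  let ?S = "mutable_subquiver F" and ?M = "mutables F" and ?s = "signed_arrows F"
  have q: "is_quiver F" using F(1) by (simp add: is_ice_quiver_def)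
  note M = signed_arrows_mutate[OF q]
  obtain r where r: "point_of_return ?S r" using F(3) by (auto simp: fork_def)
  have vS: "verts ?S = ?M"
    by (auto simp: mutable_subquiver_def full_subquiver_def mutables_def)
  have a: "arrows ?S i j = (if i \<in> ?M \<and> j \<in> ?M then arrows F i j else 0)" for i j
    unfolding vS[symmetric] by (simp add: mutable_subquiver_def full_subquiver_def)
  have pos: "arrows F i j > 0 \<longleftrightarrow> ?s i j > 0" for i j
    using int_arrows_eq[OF q, of i j] by linarith
  have sa: "signed_arrows ?S i j = ?s i j" if "i \<in> ?M" "j \<in> ?M" for i j
    using that by (simp add: signed_arrows_def a)
  have zero: "arrows F j i = 0" if "?s i j > 0" for i j
    using int_arrows_eq[OF q, of j i] signed_arrows_swap[of F j i] that by simp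
  have no_loop: "arrows F i i = 0" for i using q by (simp add: is_quiver_def)
  have rM: "r \<in> ?M" using r by (simp add: point_of_return_def vS)
  have ret: "?s j i > ?s i r \<and> ?s j i > ?s r j" if "i \<in> ?M" "j \<in> ?M" "?s i r > 0" "?s r j > 0" for i j
    using r rM that by (auto simp: point_of_return_def in_nbrs_def out_nbrs_def vS a pos sa)
  have ab: "?s i j \<ge> 2 \<or> ?s j i \<ge> 2" if "i \<in> ?M" "j \<in> ?M" "i \<noteq> j" for i j
  proof -
    have "arrows F i j + arrows F j i \<ge> 2"
      using F(3) that by (auto simp: fork_def abundant_def vS a)
    moreover have "arrows F i j = 0 \<or> arrows F j i = 0"
      using q by (auto simp: is_quiver_def)
    ultimately show ?thesis by (auto simp: signed_arrows_def)
  qed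
  have ge2: "?s i j \<ge> 2" if "i \<in> ?M" "j \<in> ?M" "?s i j > 0" for i j
    using ab[of i j] that by (cases "i = j") (auto simp: signed_arrows_def)
  have finM: "finite ?M" using F(1) by (auto simp: is_ice_quiver_def is_quiver_def mutables_def)
  let ?E = "{(i, j). i \<in> ?M - {r} \<and> j \<in> ?M - {r} \<and> ?s i j > 0}"
  have "?E = {(i, j). arrows (full_subquiver ?S (verts ?S - {r})) i j > 0}"
    by (auto simp: full_subquiver_def vS a pos[symmetric])
  then have "acyclic ?E"
    using r by (simp add: point_of_return_def acyclic_quiver_def)
  moreover have "finite ?E"
    by (rule finite_subset[of _ "?M \<times> ?M"]) (use finM in auto)
  ultimately have "wf ?E" by (simp add: finite_acyclic_wf)
  then obtain xs where xs: "distinct xs" "set xs = ?M - {r}" "sorted_wrt (\<lambda>x y. (x, y) \<in> ?E) xs"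
    using exists_topological_sorting[of "?M - {r}" ?E] finM ab by fastforce
  have sorted: "sorted_wrt (\<lambda>x y. 2 \<le> ?s x y) xs"
    using xs(3) by (rule sorted_wrt_mono_rel[rotated]) (auto intro: ge2)
  have not_sorted: "\<not> sorted_wrt (\<lambda>x y. 2 \<le> ?s x y) zs" if "set zs = ?M" for zs
  proof
    assume "sorted_wrt (\<lambda>x y. 2 \<le> ?s x y) zs"
    then have "sorted_wrt (\<lambda>x y. (y, x) \<notin> {(i, j). arrows ?S i j > 0}) zs"
      by (rule sorted_wrt_mono_rel[rotated]) (auto simp: a zero)
    then have "acyclic {(i, j). arrows ?S i j > 0}"
      by (rule acyclic_if_sorted_wrt)
        (use that no_loop in \<open>auto simp: a split: if_splits\<close>)
    then show False using F(3) by (simp add: fork_def acyclic_quiver_def)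
  qed
  \<comment> \<open>If \<open>r\<close> were a source or a sink, it could be put at the front or the
    back of \<open>xs\<close>, contradicting the cycle in the fork. Hence \<open>r\<close> has an
    in-neighbour \<open>i\<close> and an out-neighbour \<open>j\<close>.\<close>
  have "\<not> sorted_wrt (\<lambda>x y. 2 \<le> ?s x y) (r # xs)" "\<not> sorted_wrt (\<lambda>x y. 2 \<le> ?s x y) (xs @ [r])"
    by (rule not_sorted; use xs(2) rM in auto)+
  then obtain i j where ij: "i \<in> set xs" "\<not> 2 \<le> ?s r i" "j \<in> set xs" "\<not> 2 \<le> ?s j r"
    using sorted by (auto simp: sorted_wrt_append)
  then have i: "?s i r \<ge> 2" and j: "?s r j \<ge> 2"
    using xs(2) ab[of i r] ab[of j r] rM by auto
  obtain v ys where v: "xs = v # ys" using ij by (cases xs) auto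
  have vM: "v \<in> ?M" "v \<noteq> r" using v xs(2) by auto
  have vy: "?s v y \<ge> 2" if "y \<in> set ys" for y using sorted that v by simp
  \<comment> \<open>If \<open>v\<close> pointed to \<open>r\<close>, the return condition would
    force arrows from \<open>j\<close> to \<open>v\<close>, but \<open>v\<close> is a source among
    the vertices other than \<open>r\<close>.\<close>
  have rv: "?s r v \<ge> 2"
  proof (rule ccontr)
    assume "\<not> ?s r v \<ge> 2"
    then have vr: "?s v r \<ge> 2" using ab[OF vM(1) rM vM(2)] by simp
    then have "j \<noteq> v" using ij by auto
    then have "?s v j \<ge> 2" using ij(3) v vy by auto
    moreover have "?s j v > ?s v r" using ret[of v j] vM vr j ij(3) xs(2) by auto
    ultimately show False using vr signed_arrows_swap[of F j v] by linarith
  qed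
  \<comment> \<open>As \<open>i\<close> points to \<open>r\<close> but \<open>v\<close> does not,
    they differ; this makes \<open>ys\<close> nonempty.\<close>
  have iy: "i \<in> set ys" using ij(1,2) rv v by auto
  let ?t = "signed_arrows (mutate v F)"
  have same: "?t x y = ?s x y" if "x \<in> set ys" "y \<in> set ys" for x y
  proof -
    have "x \<noteq> v" "y \<noteq> v" using that xs(1) v by auto
    moreover have "?s x v \<le> 0" "?s y v \<le> 0"
      using vy that signed_arrows_swap[of F x v] signed_arrows_swap[of F y v] by fastforce+
    ultimately show ?thesis by (simp add: M)
  qed
  have sorted': "sorted_wrt (\<lambda>x y. 2 \<le> ?t x y) ys"
    using sorted same v by (auto intro: sorted_wrt_mono_rel[rotated])
  have tv: "?t x v = ?s v x" "?t v x = ?s x v" for x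
    by (simp_all add: M signed_arrows_swap[of F v])
  have "2 \<le> ?s v y \<and> ?s v y < ?t r y \<and> ?s r v < ?t r y" if "y \<in> set ys" for y
  proof -
    have y: "y \<noteq> v" "y \<in> ?M" "y \<noteq> r" using that xs(1,2) v by auto
    have "?s y v \<le> 0" using vy[OF that] signed_arrows_swap[of F y v] by linarith
    then have t: "?t r y = ?s r y + ?s r v * ?s v y"
      using y vM rv vy[OF that] by (simp add: M)
    have m: "2 * ?s v y \<le> ?s r v * ?s v y" "2 * ?s r v \<le> ?s r v * ?s v y"
      using rv vy[OF that] by (intro mult_ge_twice mult_ge_twice'; simp)+
    show ?thesis
    proof (cases "?s r y > 0")
      case True
      then show ?thesis using t m rv vy[OF that] by - (intro conjI; linarith)
    next
      case False
      \<comment> \<open>The return condition for \<open>y\<close> to \<open>r\<close> to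
        \<open>v\<close> bounds the arrows \<open>y\<close> to \<open>r\<close> by those from
        \<open>v\<close> to \<open>y\<close>, so the added paths overcome them.\<close>
      then have "?s y r > 0" using ab[OF y(2) rM y(3)] by auto
      then have "?s v y > ?s y r" "?s v y > ?s r v"
        using ret[of y v] y vM rv by auto
      then show ?thesis
        using t m vy[OF that] signed_arrows_swap[of F r y] by - (intro conjI; linarith)
    qed
  qed
  then have "cyclic_fork (mutate v F) r ys v"
    using F(1,2) xs(1,2) v vM rM iy sorted' rv
    by (auto simp: cyclic_fork_def is_ice_quiver_mutate strictly_sign_coherent_mutate tv)
  with vM(1) show ?thesis by (rule that)
qed

theorem theorem4p10:
  fixes F :: "'v ice_quiver" and n :: nat
  assumes "is_ice_quiver F"
    and "strictly_sign_coherent F"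
    and "fork (mutable_subquiver F)"
    and "card (mutables F) = n"
  shows "\<exists>ks. mutation_sequence F ks \<and> length ks \<le> 2 * n + 3 \<and>
           is_ice_quiver (mutate_seq ks F) \<and>
           fork (mutable_subquiver (mutate_seq ks F)) \<and>
           card {i. red (mutate_seq ks F) i} \<ge> n - 1"
proof -
  obtain v k ys where v: "v \<in> mutables F" "cyclic_fork (mutate v F) k ys v"
    using fork_mutate_to_cyclic_fork assms(1-3) by blast
  \<comment> \<open>One mutation reaches a cyclic fork and \<open>n + 2\<close> more suffice from
    there; \<open>n + 3\<close> is within the stated bound.\<close>
  have "reddenable F (Suc (n + 2))"
    using reddenable_mutate[OF reddenable_cyclic_fork[OF v(2)] v(1)] assms(4) by simp
  then obtain ks where ks: "mutation_sequence F ks" "length ks \<le> Suc (n + 2)"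
    "reddened (mutate_seq ks F)"
    unfolding reddenable_def by blast
  have "mutables (mutate_seq ks F) = mutables F"
    unfolding mutate_seq_def by (induction ks arbitrary: F) simp_all
  then show ?thesis
    using ks assms(4) by (intro exI[of _ ks]) (simp add: reddened_def)
qed

end
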